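(* Let $n\ge1$. For any $\alpha\in S_n$, the $n+1$ permutations $[\alpha,0],[\alpha,1],\dots,[\alpha,n]\in S_{n+1}$ are distinct. Moreover, as $\alpha$ runs over all of $S_n$, the $[\alpha,j]$ ($0\le j\le n$) give $(n+1)!$ elements, which are exactly all the permutations in $S_{n+1}$; that is, the map $S_n\times\{0,1,\dots,n\}\to S_{n+1}$, $(\alpha,j)\mapsto[\alpha,j]$, is a bijection.
   Context: For $\alpha\in S_n$, $\hat Q_\alpha$ is the directed graph (quiver) with vertices $1,\dots,n+1$ and arrows $i\to\alpha(i)$ for $2\le i\le n$ together with $n+1\to\alpha(1)$. It consists of one chain, starting at $n+1$ and ending at $1$, and possibly some loops (directed cycles, a vertex with a self-arrow being allowed). Each $t\in\{1,\dots,n\}$ is the target of exactly one arrow. One recovers $\alpha$ from $\hat Q_\alpha$ by replacing $n+1$ by $1$, so permutations $\alpha\in S_n$ correspond one-to-one to the quivers $\hat Q_\alpha$. For $\alpha\in S_n$ and $0\le j\le n$, $[\alpha,j]\in S_{n+1}$ denotes the permutation $\beta$ whose quiver $\hat Q_\beta$ (on vertices $1,\dots,n+2$) is obtained from $\hat Q_\alpha$ as follows. - If $j=0$: add the vertex $n+2$ and the arrow $n+2\to n+1$. - If $j\ge1$: let $i\to j$ be the unique arrow of $\hat Q_\alpha$ with target $j$; delete this arrow, add the vertex $n+2$, and add the two arrows $n+2\to j$ and $i\to n+1$. In each case the resulting directed graph again consists of a chain from $n+2$ to $1$ and possibly some loops, and $\beta$ is read off by replacing $n+2$ by $1$. *)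

theory Defs
  imports "HOL-Combinatorics.Permutations" "Graph_Theory.Pair_Digraph"
begin

definition sym_perms :: "nat \<Rightarrow> (nat \<Rightarrow> nat) set" where
  "sym_perms n = {\<alpha>. \<alpha> permutes {1..n}}"

text \<open>The quiver of \<open>\<alpha> \<in> S\<^sub>n\<close>. No two of its arrows share their source, so a set of
  ordered pairs (without multiplicities) represents the arrows faithfully.\<close>

definition quiver :: "nat \<Rightarrow> (nat \<Rightarrow> nat) \<Rightarrow> nat pair_pre_digraph" where
  "quiver n \<alpha> =
     \<lparr>pverts = {1..n + 1}, parcs = {(i, \<alpha> i) | i. 2 \<le> i \<and> i \<le> n} \<union> {(n + 1, \<alpha> 1)}\<rparr>"

definition extend_quiver :: "nat \<Rightarrow> nat pair_pre_digraph \<Rightarrow> nat \<Rightarrow> nat pair_pre_digraph" where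
  "extend_quiver n Q j =
     (if j = 0 then
        \<lparr>pverts = pverts Q \<union> {n + 2}, parcs = parcs Q \<union> {(n + 2, n + 1)}\<rparr>
      else
        (let i = (THE i. (i, j) \<in> parcs Q) in
          \<lparr>pverts = pverts Q \<union> {n + 2},
           parcs = (parcs Q - {(i, j)}) \<union> {(n + 2, j), (i, n + 1)}\<rparr>))"

text \<open>The permutation \<open>[\<alpha>, j] \<in> S\<^bsub>n+1\<^esub>\<close>, for \<open>\<alpha> \<in> S\<^sub>n\<close> and \<open>j \<le> n\<close>.\<close>

definition ext_perm :: "nat \<Rightarrow> (nat \<Rightarrow> nat) \<Rightarrow> nat \<Rightarrow> (nat \<Rightarrow> nat)" where
  "ext_perm n \<alpha> j =
     (THE \<beta>. \<beta> \<in> sym_perms (n + 1) \<and> quiver (n + 1) \<beta> = extend_quiver n (quiver n \<alpha>) j)"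

end

theory Submission
  imports Defs
begin

text \<open>
  Write \<open>\<tau>\<^sub>n\<close> for the transposition of \<open>1\<close> and \<open>n + 1\<close>. Calling the start of the chain
  \<open>n + 1\<close> instead of \<open>1\<close> means that the arrows of the quiver of \<open>\<alpha>\<close> are the graph of
  \<open>\<alpha> \<circ> \<tau>\<^sub>n\<close> on \<open>{2..n + 1}\<close>. Here \<open>\<alpha> \<in> S\<^sub>n\<close> also fixes \<open>n + 1\<close>, so \<open>\<alpha> \<circ> \<tau>\<^sub>n \<in> S\<^bsub>n+1\<^esub>\<close>
  agrees with the quiver on \<open>{2..n + 1}\<close> and sends \<open>1\<close> to \<open>n + 1\<close>. Read as the permutation of a
  quiver on \<open>n + 2\<close> vertices, it has the same arrows and one more, from \<open>n + 2\<close> to \<open>n + 1\<close>;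
  hence it is \<open>[\<alpha>, 0]\<close>. For \<open>j \<ge> 1\<close> the quiver of \<open>[\<alpha>, j]\<close> arises from that of \<open>[\<alpha>, 0]\<close> by
  exchanging the targets of the two arrows into \<open>j\<close> and \<open>n + 1\<close>. With \<open>k = n + 1\<close> if \<open>j = 0\<close>, and
  \<open>k = j\<close> otherwise, both cases become (for \<open>k = n + 1\<close> the left factor is the identity)
    \<open>[\<alpha>, j] = (k n+1) \<circ> \<alpha> \<circ> (1 n+1)\<close>,
  which is proved in \<open>ext_perm_eq_insert_perm\<close>.

  This is the classical coset decomposition of \<open>S\<^bsub>n+1\<^esub>\<close> by the stabilizer \<open>S\<^sub>n\<close> of \<open>n + 1\<close>: such
  a product sends \<open>1\<close> to \<open>k\<close>, so it determines \<open>k\<close> and then \<open>\<alpha>\<close>. Conversely, for any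
  \<open>\<beta> \<in> S\<^bsub>n+1\<^esub>\<close> and \<open>k = \<beta>(1)\<close>, the permutation \<open>(k n+1) \<circ> \<beta> \<circ> (1 n+1)\<close> fixes \<open>n + 1\<close>, so it
  lies in \<open>S\<^sub>n\<close> (\<open>bij_betw_insert_perm\<close>).
\<close>

definition insert_perm :: "nat \<Rightarrow> (nat \<Rightarrow> nat) \<Rightarrow> nat \<Rightarrow> (nat \<Rightarrow> nat)" where
  "insert_perm n \<alpha> k = transpose k (n + 1) \<circ> \<alpha> \<circ> transpose 1 (n + 1)"

lemma permutes_Suc_interval:
  fixes \<alpha> :: "nat \<Rightarrow> nat"
  assumes "\<alpha> permutes {1..n}"
  shows "\<alpha> permutes {1..n + 1}"
  using assms by (rule permutes_subset) auto

lemma permutes_fixes_last: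
  fixes \<alpha> :: "nat \<Rightarrow> nat"
  assumes "\<alpha> permutes {1..n}"
  shows "\<alpha> (n + 1) = n + 1"
  using assms by (rule permutes_not_in) simp

lemma insert_perm_permutes:
  assumes "\<alpha> permutes {1..n + 1}" "k \<in> {1..n + 1}"
  shows "insert_perm n \<alpha> k permutes {1..n + 1}"
  unfolding insert_perm_def
  using assms by (intro permutes_compose permutes_swap_id) auto

lemma insert_perm_at_1:
  assumes "\<alpha> permutes {1..n}"
  shows "insert_perm n \<alpha> k 1 = k"
  using permutes_fixes_last[OF assms] by (simp add: insert_perm_def)

text \<open>Both outer factors are involutions, so the same construction strips them off again.\<close>

lemma insert_perm_insert_perm [simp]: "insert_perm n (insert_perm n \<alpha> k) k = \<alpha>"
  by (simp add: insert_perm_def fun_eq_iff)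

text \<open>The inverse map is \<open>\<beta> \<mapsto> (insert_perm n \<beta> (\<beta> 1), \<beta> 1)\<close>: the index is the image of \<open>1\<close>, and
  moving that image to \<open>n + 1\<close> leaves a permutation with fixed point \<open>n + 1\<close>.\<close>

lemma bij_betw_insert_perm:
  "bij_betw (\<lambda>(\<alpha>, k). insert_perm n \<alpha> k) (sym_perms n \<times> {1..n + 1}) (sym_perms (n + 1))"
proof (rule bij_betw_byWitness[where f' = "\<lambda>\<beta>. (insert_perm n \<beta> (\<beta> 1), \<beta> 1)"])
  show "\<forall>a \<in> sym_perms n \<times> {1..n + 1}.
      (\<lambda>\<beta>. (insert_perm n \<beta> (\<beta> 1), \<beta> 1)) ((\<lambda>(\<alpha>, k). insert_perm n \<alpha> k) a) = a"
    by (auto simp: sym_perms_def insert_perm_at_1[unfolded One_nat_def])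
  show "\<forall>\<beta> \<in> sym_perms (n + 1).
      (\<lambda>(\<alpha>, k). insert_perm n \<alpha> k) ((\<lambda>\<beta>. (insert_perm n \<beta> (\<beta> 1), \<beta> 1)) \<beta>) = \<beta>"
    by simp
  show "(\<lambda>(\<alpha>, k). insert_perm n \<alpha> k) ` (sym_perms n \<times> {1..n + 1}) \<subseteq> sym_perms (n + 1)"
  proof clarify
    fix \<alpha> k assume "\<alpha> \<in> sym_perms n" and k: "k \<in> {1..n + 1}"
    then have "\<alpha> permutes {1..n + 1}"
      unfolding sym_perms_def by (intro permutes_Suc_interval) simp
    from insert_perm_permutes[OF this k] show "insert_perm n \<alpha> k \<in> sym_perms (n + 1)"
      by (simp add: sym_perms_def)
  qed
  show "(\<lambda>\<beta>. (insert_perm n \<beta> (\<beta> 1), \<beta> 1)) ` sym_perms (n + 1) \<subseteq> sym_perms n \<times> {1..n + 1}"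
  proof (rule image_subsetI)
    fix \<beta> assume "\<beta> \<in> sym_perms (n + 1)"
    then have \<beta>: "\<beta> permutes {1..n + 1}" by (simp add: sym_perms_def)
    then have 1: "\<beta> 1 \<in> {1..n + 1}" by (subst permutes_in_image) auto
    have "insert_perm n \<beta> (\<beta> 1) permutes {1..n}"
    proof (rule permutes_superset)
      show "insert_perm n \<beta> (\<beta> 1) permutes {1..n + 1}"
        using \<beta> 1 by (rule insert_perm_permutes)
      show "insert_perm n \<beta> (\<beta> 1) x = x" if "x \<in> {1..n + 1} - {1..n}" for x
      proof -
        have "x = n + 1" using that by auto
        then show ?thesis by (simp add: insert_perm_def)
      qed
    qed
    then show "(insert_perm n \<beta> (\<beta> 1), \<beta> 1) \<in> sym_perms n \<times> {1..n + 1}"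
      using 1 by (simp add: sym_perms_def)
  qed
qed

lemma arc_quiver_iff:
  assumes "n \<ge> 1"
  shows "(s, t) \<in> parcs (quiver n \<alpha>) \<longleftrightarrow> s \<in> {2..n + 1} \<and> t = \<alpha> (transpose 1 (n + 1) s)"
  using assms by (auto simp: quiver_def transpose_def)

text \<open>The arrows show \<open>\<alpha>\<close> at every point of \<open>{1..n}\<close>, the point \<open>1\<close> through the source \<open>n + 1\<close>.\<close>

lemma quiver_inj:
  assumes "n \<ge> 1" "\<alpha> permutes {1..n}" "\<beta> permutes {1..n}" "quiver n \<alpha> = quiver n \<beta>"
  shows "\<alpha> = \<beta>"
proof
  fix x
  show "\<alpha> x = \<beta> x"
  proof (cases "x \<in> {1..n}")
    case True
    define s where "s = transpose 1 (n + 1) x"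
    have "s \<in> {2..n + 1}" and x: "transpose 1 (n + 1) s = x"
      using True assms(1) by (auto simp: s_def transpose_def)
    then have "(s, \<alpha> x) \<in> parcs (quiver n \<beta>)"
      using assms(1,4) by (metis arc_quiver_iff)
    then show ?thesis using x assms(1) by (simp add: arc_quiver_iff)
  next
    case False
    then show ?thesis using assms(2,3) by (metis permutes_not_in)
  qed
qed

lemma quiver_insert_perm:
  assumes n: "n \<ge> 1" and \<alpha>: "\<alpha> permutes {1..n}" and j: "j \<le> n"
  shows "quiver (n + 1) (insert_perm n \<alpha> (if j = 0 then n + 1 else j))
    = extend_quiver n (quiver n \<alpha>) j"
proof -
  define f where "f = \<alpha> \<circ> transpose 1 (n + 1)"
  have f: "f permutes {1..n + 1}"
    unfolding f_def using permutes_Suc_interval[OF \<alpha>]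
    by (intro permutes_compose permutes_swap_id) auto
  have f1: "f 1 = n + 1" using permutes_fixes_last[OF \<alpha>] by (simp add: f_def)
  have f_neq: "f s \<noteq> n + 1" if "s \<noteq> 1" for s
    using that f1 permutes_inj[OF f] by (metis injD)
  have arcs: "(s, t) \<in> parcs (quiver n \<alpha>) \<longleftrightarrow> s \<in> {2..n + 1} \<and> t = f s" for s t
    using n by (simp add: arc_quiver_iff f_def)
  have arcs': "(s, t) \<in> parcs (quiver (n + 1) (insert_perm n \<alpha> k)) \<longleftrightarrow>
      s \<in> {2..n + 1} \<and> t = transpose k (n + 1) (f s) \<or> s = n + 2 \<and> t = k" for s t k
  proof -
    have "insert_perm n \<alpha> k x = transpose k (n + 1) (f x)" for x
      by (simp add: insert_perm_def f_def)
    moreover have "transpose 1 (n + 2) s = s" if "s \<in> {2..n + 1}"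
      using that by (auto simp: transpose_def)
    moreover have "s \<in> {2..n + 2} \<longleftrightarrow> s \<in> {2..n + 1} \<or> s = n + 2" by auto
    ultimately show ?thesis
      using f1 by (subst arc_quiver_iff) (auto simp: insert_perm_at_1[OF \<alpha>, unfolded One_nat_def])
  qed
  have verts: "pverts (quiver (n + 1) \<beta>) = pverts (extend_quiver n (quiver n \<alpha>) j)" for \<beta>
    by (auto simp: quiver_def extend_quiver_def Let_def)
  have "parcs (quiver (n + 1) (insert_perm n \<alpha> (if j = 0 then n + 1 else j)))
    = parcs (extend_quiver n (quiver n \<alpha>) j)"
  proof (cases "j = 0")
    case True
    show ?thesis
    proof (rule set_eqI, clarify)
      fix s t
      show "(s, t) \<in> parcs (quiver (n + 1) (insert_perm n \<alpha> (if j = 0 then n + 1 else j)))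
        \<longleftrightarrow> (s, t) \<in> parcs (extend_quiver n (quiver n \<alpha>) j)"
        unfolding arcs' using True by (auto simp: extend_quiver_def arcs)
    qed
  next
    case False
    \<comment> \<open>The source of the arrow into \<open>j\<close>; it is not \<open>1\<close>, which \<open>f\<close> sends to \<open>n + 1 > j\<close>.\<close>
    define i where "i = inv f j"
    have fi: "f s = j \<longleftrightarrow> s = i" for s
      unfolding i_def using permutes_inv_eq[OF f] by metis
    have i: "i \<in> {2..n + 1}"
    proof -
      have "i \<in> {1..n + 1}"
        unfolding i_def using permutes_inv[OF f] False j by (subst permutes_in_image) auto
      moreover have "i \<noteq> 1" using fi f1 j by (metis Suc_eq_plus1 not_less_eq_eq order_refl)
      ultimately show ?thesis by auto
    qed
    have source: "(THE i. (i, j) \<in> parcs (quiver n \<alpha>)) = i"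
      using i fi[of i] fi by (intro the_equality) (force simp: arcs)+
    have swap: "transpose j (n + 1) (f s) = (if s = i then n + 1 else f s)"
      if "s \<in> {2..n + 1}" for s
      using fi[of s] f_neq[of s] that by (auto simp: transpose_def)
    have extended: "(s, t) \<in> parcs (extend_quiver n (quiver n \<alpha>) j) \<longleftrightarrow>
        s \<in> {2..n + 1} \<and> t = f s \<and> s \<noteq> i \<or> s = n + 2 \<and> t = j \<or> s = i \<and> t = n + 1" for s t
    proof -
      have "parcs (extend_quiver n (quiver n \<alpha>) j) =
          parcs (quiver n \<alpha>) - {(i, j)} \<union> {(n + 2, j), (i, n + 1)}"
        using False by (simp add: extend_quiver_def source)
      then show ?thesis using fi[of s] by (auto simp: arcs)
    qed
    show ?thesis
    proof (rule set_eqI, clarify)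
      fix s t
      show "(s, t) \<in> parcs (quiver (n + 1) (insert_perm n \<alpha> (if j = 0 then n + 1 else j)))
        \<longleftrightarrow> (s, t) \<in> parcs (extend_quiver n (quiver n \<alpha>) j)"
        unfolding arcs' extended using False i swap[of s] by (cases "s = i") auto
    qed
  qed
  with verts show ?thesis by (intro pair_pre_digraph.equality) auto
qed

lemma ext_perm_eq_insert_perm:
  assumes "n \<ge> 1" "\<alpha> permutes {1..n}" "j \<le> n"
  shows "ext_perm n \<alpha> j = insert_perm n \<alpha> (if j = 0 then n + 1 else j)"
  unfolding ext_perm_def
proof (rule the_equality)
  let ?\<beta> = "insert_perm n \<alpha> (if j = 0 then n + 1 else j)"
  have \<beta>: "?\<beta> permutes {1..n + 1}"
    using assms by (intro insert_perm_permutes permutes_Suc_interval) auto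
  show "?\<beta> \<in> sym_perms (n + 1) \<and> quiver (n + 1) ?\<beta> = extend_quiver n (quiver n \<alpha>) j"
    using \<beta> quiver_insert_perm[OF assms] by (simp add: sym_perms_def)
  fix \<gamma>
  assume "\<gamma> \<in> sym_perms (n + 1) \<and> quiver (n + 1) \<gamma> = extend_quiver n (quiver n \<alpha>) j"
  then show "\<gamma> = ?\<beta>"
    using \<beta> quiver_insert_perm[OF assms] by (intro quiver_inj) (auto simp: sym_perms_def)
qed

theorem theorem2p3:
  fixes n :: nat
  assumes "n \<ge> 1"
  shows "(\<forall>\<alpha> \<in> sym_perms n. inj_on (\<lambda>j. ext_perm n \<alpha> j) {0..n})
    \<and> card ((\<lambda>(\<alpha>, j). ext_perm n \<alpha> j) ` (sym_perms n \<times> {0..n})) = fact (n + 1)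
    \<and> (\<lambda>(\<alpha>, j). ext_perm n \<alpha> j) ` (sym_perms n \<times> {0..n}) = sym_perms (n + 1)
    \<and> bij_betw (\<lambda>(\<alpha>, j). ext_perm n \<alpha> j) (sym_perms n \<times> {0..n}) (sym_perms (n + 1))"
proof -
  let ?k = "\<lambda>j. if j = 0 then n + 1 else j"
  have "bij_betw ?k {0..n} {1..n + 1}"
    by (rule bij_betw_byWitness[where f' = "\<lambda>k. if k = n + 1 then 0 else k"]) auto
  then have "bij_betw (map_prod id ?k) (sym_perms n \<times> {0..n}) (sym_perms n \<times> {1..n + 1})"
    by (intro bij_betw_map_prod) auto
  from bij_betw_trans[OF this bij_betw_insert_perm]
  have bij: "bij_betw (\<lambda>(\<alpha>, j). ext_perm n \<alpha> j) (sym_perms n \<times> {0..n}) (sym_perms (n + 1))"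
    by (rule bij_betw_cong[THEN iffD1, rotated])
      (auto simp: sym_perms_def ext_perm_eq_insert_perm[OF assms])
  have inj: "inj_on (\<lambda>j. ext_perm n \<alpha> j) {0..n}" if "\<alpha> \<in> sym_perms n" for \<alpha>
    using bij_betw_imp_inj_on[OF bij] that by (auto simp: inj_on_def)
  have "card (sym_perms (n + 1)) = fact (n + 1)"
    unfolding sym_perms_def by (rule card_permutations) auto
  with bij inj show ?thesis by (simp add: bij_betw_imp_surj_on)
qed

end
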